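(* Let $G$ be either $OTIS(BF(2m+1,2n+1))$ with integers $m,n\ge 1$, or $OTIS(BF(2m+1,2k))$ with integers $m\ge 1$, $k\ge 2$. Then any set of pairwise edge-disjoint Hamiltonian cycles of $G$ has at most one element.
   Context: All graphs are finite, simple and undirected. For integers $p,q\ge 3$, the (generalized) butterfly/bowtie graph $BF(p,q)$ is the graph consisting of two cycles $C_p$ and $C_q$ (on $p$ and $q$ vertices) sharing exactly one vertex, which is a cutvertex. Explicitly, its vertex set is $\{1,2,\dots,p+q-1\}$; with $c=p$, the vertices $1,2,\dots,c$ form in this cyclic order the cycle $C_p$, and the vertices $c,c+1,\dots,p+q-1$ form in this cyclic order the cycle $C_q$; there are no other edges. For a graph $G$, the graph $OTIS(G)$ has vertex set $\{\langle u,v\rangle : u,v\in V(G)\}$ and edge set $$\{(\langle v,u\rangle,\langle v,u'\rangle) : v\in V(G),\ (u,u')\in E(G)\}\ \cup\ \{(\langle v,u\rangle,\langle u,v\rangle) : u,v\in V(G),\ u\ne v\}.$$ A Hamiltonian cycle is a cycle (regarded as a subgraph) passing through every vertex exactly once. *)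

theory Defs imports Main begin

(* Finite simple undirected graphs: an edge is the two-element set of its ends. *)
record 'a graph =
  verts :: "'a set"
  edges :: "'a set set"

definition simple_graph :: "'a graph \<Rightarrow> bool" where
  "simple_graph G \<longleftrightarrow> finite (verts G) \<and> (\<forall>e\<in>edges G. e \<subseteq> verts G \<and> card e = 2)"

definition subgraph :: "'a graph \<Rightarrow> 'a graph \<Rightarrow> bool" where
  "subgraph H G \<longleftrightarrow> verts H \<subseteq> verts G \<and> edges H \<subseteq> edges G"

definition cycle_edges :: "'a list \<Rightarrow> 'a set set" where
  "cycle_edges xs = {{xs ! i, xs ! (Suc i mod length xs)} | i. i < length xs}"

definition is_cycle :: "'a graph \<Rightarrow> bool" where
  "is_cycle H \<longleftrightarrow> (\<exists>xs. 3 \<le> length xs \<and> distinct xs \<and>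
     verts H = set xs \<and> edges H = cycle_edges xs)"

(* A cycle is a subgraph, so neither its orientation nor its starting vertex is recorded. *)
definition hamiltonian_cycle :: "'a graph \<Rightarrow> 'a graph \<Rightarrow> bool" where
  "hamiltonian_cycle G H \<longleftrightarrow> is_cycle H \<and> subgraph H G \<and> verts H = verts G"

definition edge_disjoint :: "'a graph \<Rightarrow> 'a graph \<Rightarrow> bool" where
  "edge_disjoint H H' \<longleftrightarrow> edges H \<inter> edges H' = {}"

(* Two cycles, on 1, ..., p and on p, ..., p + q - 1, sharing the vertex p; meant for p, q \<ge> 3. *)
definition BF :: "nat \<Rightarrow> nat \<Rightarrow> nat graph" where
  "BF p q = \<lparr> verts = {1..p + q - 1},
     edges = cycle_edges [1..<p + 1] \<union> cycle_edges [p..<p + q] \<rparr>"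

definition OTIS :: "'a graph \<Rightarrow> ('a \<times> 'a) graph" where
  "OTIS G = \<lparr> verts = verts G \<times> verts G,
     edges = {{(v, u), (v, u')} | v u u'. v \<in> verts G \<and> {u, u'} \<in> edges G}
       \<union> {{(v, u), (u, v)} | u v. u \<in> verts G \<and> v \<in> verts G \<and> u \<noteq> v} \<rparr>"

lemma cycle_edges_simple:
  assumes "2 \<le> length xs" "distinct xs" "e \<in> cycle_edges xs"
  shows "e \<subseteq> set xs" "card e = 2"
proof -
  obtain i where i: "i < length xs" "e = {xs ! i, xs ! (Suc i mod length xs)}"
    using assms(3) by (auto simp: cycle_edges_def)
  have j: "Suc i mod length xs < length xs" using i(1) by (intro mod_less_divisor) linarith
  have "Suc i mod length xs \<noteq> i"
    using i(1) assms(1) by (cases "Suc i = length xs") auto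
  then have "xs ! i \<noteq> xs ! (Suc i mod length xs)"
    using nth_eq_iff_index_eq[OF assms(2) i(1) j] by metis
  then show "card e = 2" using i(2) by simp
  show "e \<subseteq> set xs" using i j by simp
qed

lemma simple_graph_BF:
  assumes "3 \<le> p" "3 \<le> q"
  shows "simple_graph (BF p q)"
proof -
  have "e \<subseteq> {1..p + q - 1} \<and> card e = 2" if "e \<in> cycle_edges [1..<p + 1]" for e
    using cycle_edges_simple[OF _ _ that] assms by fastforce
  moreover have "e \<subseteq> {1..p + q - 1} \<and> card e = 2" if "e \<in> cycle_edges [p..<p + q]" for e
    using cycle_edges_simple[OF _ _ that] assms by fastforce
  ultimately show ?thesis
    unfolding simple_graph_def BF_def graph.simps by (metis Un_iff finite_atLeastAtMost)
qed

lemma simple_graph_OTIS: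
  assumes "simple_graph G"
  shows "simple_graph (OTIS G)"
proof -
  have *: "u \<in> verts G \<and> u' \<in> verts G \<and> u \<noteq> u'" if "{u, u'} \<in> edges G" for u u'
    using assms that by (auto simp: simple_graph_def card_2_iff doubleton_eq_iff)
  have "card {(v, u), (v, u')} = 2" if "{u, u'} \<in> edges G" for u u' v
    using *[OF that] by simp
  then show ?thesis using * assms by (auto simp: simple_graph_def OTIS_def)
qed

end

(* The vertex (u, u) of OTIS (BF p q) has no swap edge, so for u other than the cutvertex it
   has degree 2, and every Hamiltonian cycle contains both edges at it. *)
theory Submission imports Defs begin

text \<open>The vertex \<open>(1, 1)\<close> is an obstruction to disjointness: its only possible
  neighbours are \<open>(1, 2)\<close> and \<open>(1, p)\<close>. A Hamiltonian cycle needs two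
  edges there, so it contains the edge to \<open>(1, 2)\<close>
  (\<open>OTIS_BF_hamiltonian_cycle_edge\<close>). All Hamiltonian cycles share this edge, so no two
  distinct ones are edge-disjoint. Both families are instances of p, q \<ge> 3.\<close>

lemma is_cycle_two_neighbours:
  assumes "is_cycle H" "v \<in> verts H"
  obtains a b where "a \<noteq> b" "{v, a} \<in> edges H" "{v, b} \<in> edges H"
proof -
  obtain xs where xs: "3 \<le> length xs" "distinct xs" "verts H = set xs" "edges H = cycle_edges xs"
    using assms(1) by (auto simp: is_cycle_def)
  define n where "n = length xs"
  obtain i where i: "i < n" "v = xs ! i"
    using assms(2) xs(3) by (auto simp: in_set_conv_nth n_def)
  \<comment> \<open>The cyclic predecessor of \<open>i\<close>; the case split avoids truncated
    subtraction at 0.\<close>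
  define j where "j = (if i = 0 then n - 1 else i - 1)"
  have j: "j < n" "Suc j mod n = i"
    using i xs(1) by (auto simp: j_def n_def)
  have k: "Suc i mod n < n"
    using i by (intro mod_less_divisor) linarith
  \<comment> \<open>Predecessor and successor differ because the cycle has length at least
    3.\<close>
  have "Suc i mod n \<noteq> j"
    using i xs(1) by (cases "Suc i = n") (auto simp: j_def n_def)
  then have "xs ! (Suc i mod n) \<noteq> xs ! j"
    using nth_eq_iff_index_eq[OF xs(2)] j(1) k unfolding n_def by metis
  moreover have "{v, xs ! (Suc i mod n)} \<in> edges H"
    using i xs(4) by (auto simp: cycle_edges_def n_def)
  moreover have "{xs ! j, xs ! (Suc j mod n)} \<in> edges H"
    using j(1) unfolding xs(4) cycle_edges_def n_def by blast
  then have "{v, xs ! j} \<in> edges H"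
    using j(2) i(2) by (simp add: insert_commute)
  ultimately show thesis by (rule that)
qed

text \<open>The two distinct neighbours of \<open>v\<close> on the cycle both lie in {x, y}, so one
  of them is \<open>x\<close>.\<close>

lemma hamiltonian_cycle_degree_two_edge:
  assumes "hamiltonian_cycle G H" "v \<in> verts G"
    and "\<And>w. {v, w} \<in> edges G \<Longrightarrow> w = x \<or> w = y"
  shows "{v, x} \<in> edges H"
proof -
  have "is_cycle H" "v \<in> verts H" and sub: "edges H \<subseteq> edges G"
    using assms(1,2) by (auto simp: hamiltonian_cycle_def subgraph_def)
  then obtain a b where "a \<noteq> b" "{v, a} \<in> edges H" "{v, b} \<in> edges H"
    by (elim is_cycle_two_neighbours)
  then show ?thesis using assms(3) sub by blast
qed

lemma BF_neighbours_of_1: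
  assumes "3 \<le> p" "3 \<le> q" "{1, u} \<in> edges (BF p q)"
  shows "u = 2 \<or> u = p"
proof -
  \<comment> \<open>The second cycle has only vertices \<ge> p > 1.\<close>
  have "{1, u} \<notin> cycle_edges [p..<p + q]"
    using cycle_edges_simple(1)[of "[p..<p + q]" "{1, u}"] assms(1,2) by auto
  then have "{1, u} \<in> cycle_edges [1..<p + 1]"
    using assms(3) by (simp add: BF_def)
  then obtain i where i: "i < p" "{1, u} = {Suc i, Suc (Suc i mod p)}"
    using assms(1) by (auto simp: cycle_edges_def simp del: upt_Suc)
  \<comment> \<open>The closing edge {p, 1} gives \<open>u = p\<close>; any other edge {i + 1, i +
    2} contains 1 only for i = 0, giving \<open>u = 2\<close>.\<close>
  show ?thesis
    using i assms(1) by (cases "Suc i = p") (auto simp: doubleton_eq_iff)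
qed

text \<open>Swap edges join distinct transposed pairs, so none meets the diagonal.\<close>

lemma OTIS_diagonal_neighbour:
  assumes "{(v, v), w} \<in> edges (OTIS G)"
  obtains u where "w = (v, u)" "{v, u} \<in> edges G"
  using assms by (auto simp: OTIS_def doubleton_eq_iff insert_commute)

lemma OTIS_BF_hamiltonian_cycle_edge:
  assumes "3 \<le> p" "3 \<le> q" "hamiltonian_cycle (OTIS (BF p q)) H"
  shows "{(1, 1), (1, 2)} \<in> edges H"
proof (rule hamiltonian_cycle_degree_two_edge[OF assms(3)])
  show "(1, 1) \<in> verts (OTIS (BF p q))"
    using assms(1) by (simp add: OTIS_def BF_def)
  show "w = (1, 2) \<or> w = (1, p)" if "{(1, 1), w} \<in> edges (OTIS (BF p q))" for w
    using that BF_neighbours_of_1[OF assms(1,2)] by (elim OTIS_diagonal_neighbour) auto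
qed

theorem mainTheorem3:
  fixes G :: "(nat \<times> nat) graph" and S :: "(nat \<times> nat) graph set"
  assumes "(\<exists>m n. 1 \<le> m \<and> 1 \<le> n \<and> G = OTIS (BF (2 * m + 1) (2 * n + 1)))
         \<or> (\<exists>m k. 1 \<le> m \<and> 2 \<le> k \<and> G = OTIS (BF (2 * m + 1) (2 * k)))"
    and "\<forall>C\<in>S. hamiltonian_cycle G C"
    and "pairwise edge_disjoint S"
  shows "finite S \<and> card S \<le> 1"
proof -
  obtain p q where "3 \<le> p" "3 \<le> q" "G = OTIS (BF p q)"
  proof -
    from assms(1) consider
        m n where "1 \<le> m" "1 \<le> n" "G = OTIS (BF (2 * m + 1) (2 * n + 1))"
      | m k where "1 \<le> m" "2 \<le> k" "G = OTIS (BF (2 * m + 1) (2 * k))"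
      by blast
    then show thesis by cases (rule that; simp)+
  qed
  then have "{(1, 1), (1, 2)} \<in> edges C" if "C \<in> S" for C
    using OTIS_BF_hamiltonian_cycle_edge assms(2) that by blast
  \<comment> \<open>\<open>pairwise\<close> constrains distinct members only; if C and D were
    distinct, the common edge would contradict disjointness.\<close>
  then have "C = D" if "C \<in> S" "D \<in> S" for C D
    using assms(3) that unfolding pairwise_def edge_disjoint_def by blast
  then have "S = {} \<or> (\<exists>C. S = {C})" by blast
  then show ?thesis by auto
qed

end
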